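(* Let $H$ and $H_1,\dots,H_m$ be finite-dimensional Hilbert spaces and let $\{V_j\}_{j=1}^m$, $V_j\in B(H,H_j)$, be a Parseval (OPV)-frame for $H$ which admits a tight dual (OPV)-frame $\{W_j\}_{j=1}^m$, $W_j\in B(H,H_j)$, with frame bound $A>0$. Then $A\ge 1$.
   Context: Hilbert spaces are over $\mathbb{R}$ or $\mathbb{C}$ and nonzero. A family $V_j\in B(H,H_j)$, $j=1,\dots,m$, is a tight operator-valued frame (tight (OPV)-frame) for $H$ with frame bound $A>0$ if $\sum_{j=1}^m V_j^*V_j=AI$, and it is Parseval if $A=1$. A family $\{W_j\}_{j=1}^m$, $W_j\in B(H,H_j)$, is dual to $\{V_j\}_{j=1}^m$ if $\sum_{j=1}^m W_j^*V_j=I$. *)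

theory Defs
  imports "HOL-Analysis.Analysis" "Jordan_Normal_Form.Missing_VectorSpace"
begin

text \<open>
  Real and complex Hilbert spaces are treated uniformly: the scalars are a subset \<open>F\<close> of the
  complex numbers, which the locale \<open>hilbert_space\<close> requires to be \<open>\<real>\<close> or everything.
  Spaces are records with explicit carriers, so that the members of a family \<open>H\<^sub>1, \<dots>, H\<^sub>m\<close> may
  have different dimensions, operations and inner products even though their points share one HOL
  type.
\<close>

definition scalars :: "complex set \<Rightarrow> complex ring"
  where "scalars F = \<lparr>carrier = F, mult = (*), one = 1, zero = 0, add = (+)\<rparr>"

text \<open>The multiplicative fields inherited from the ring record play no role for vectors.\<close>

record 'a ip_space = "(complex, 'a) module" +
  ip :: "'a \<Rightarrow> 'a \<Rightarrow> complex"

definition hnorm :: "'a ip_space \<Rightarrow> 'a \<Rightarrow> real"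
  where "hnorm H x = sqrt (Re (ip H x x))"

text \<open>
  The value 0 off the carrier is a dummy: \<^locale>\<open>Metric_space\<close> asks for nonnegativity and symmetry
  of the distance on the whole type.
\<close>

definition hdist :: "'a ip_space \<Rightarrow> 'a \<Rightarrow> 'a \<Rightarrow> real"
  where "hdist H x y =
    (if x \<in> carrier H \<and> y \<in> carrier H then hnorm H (x \<ominus>\<^bsub>H\<^esub> y) else 0)"

text \<open>The inner product is linear in its first argument; the zero space is excluded.\<close>

locale hilbert_space = vectorspace "scalars F" H
  for F :: "complex set" and H :: "'a ip_space" (structure) +
  assumes real_or_complex: "F = \<real> \<or> F = UNIV"
    and ip_closed: "\<lbrakk>x \<in> carrier H; y \<in> carrier H\<rbrakk> \<Longrightarrow> ip H x y \<in> F"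
    and ip_add: "\<lbrakk>x \<in> carrier H; y \<in> carrier H; z \<in> carrier H\<rbrakk> \<Longrightarrow>
      ip H (x \<oplus> y) z = ip H x z + ip H y z"
    and ip_smult: "\<lbrakk>c \<in> F; x \<in> carrier H; y \<in> carrier H\<rbrakk> \<Longrightarrow>
      ip H (c \<odot>\<^bsub>H\<^esub> x) y = c * ip H x y"
    and ip_cnj: "\<lbrakk>x \<in> carrier H; y \<in> carrier H\<rbrakk> \<Longrightarrow> ip H y x = cnj (ip H x y)"
    and ip_nonneg: "x \<in> carrier H \<Longrightarrow> 0 \<le> Re (ip H x x)"
    and ip_definite: "\<lbrakk>x \<in> carrier H; ip H x x = 0\<rbrakk> \<Longrightarrow> x = \<zero>"
    and nonzero: "carrier H \<noteq> {\<zero>}"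
    and complete: "Metric_space.mcomplete (carrier H) (hdist H)"

definition bounded_ops :: "complex set \<Rightarrow> 'a ip_space \<Rightarrow> 'b ip_space \<Rightarrow> ('a \<Rightarrow> 'b) set"
  where "bounded_ops F H K =
    {T. linear_map (scalars F) H K T \<and> (\<exists>C. \<forall>x\<in>carrier H. hnorm K (T x) \<le> C * hnorm H x)}"

text \<open>
  Only values on carriers are meaningful; there the adjoint of a bounded operator between Hilbert
  spaces is uniquely determined.
\<close>

definition hadjoint ::
    "complex set \<Rightarrow> 'a ip_space \<Rightarrow> 'b ip_space \<Rightarrow> ('a \<Rightarrow> 'b) \<Rightarrow> 'b \<Rightarrow> 'a"
  where "hadjoint F H K T = (SOME S. S \<in> bounded_ops F K H \<and>
    (\<forall>x\<in>carrier H. \<forall>y\<in>carrier K. ip K (T x) y = ip H x (S y)))"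

definition opv_family ::
    "complex set \<Rightarrow> 'a ip_space \<Rightarrow> (nat \<Rightarrow> 'b ip_space) \<Rightarrow> nat \<Rightarrow> (nat \<Rightarrow> 'a \<Rightarrow> 'b) \<Rightarrow> bool"
  where "opv_family F H Hs m V \<longleftrightarrow> (\<forall>j\<in>{1..m}. V j \<in> bounded_ops F H (Hs j))"

definition tight_opv_frame ::
    "complex set \<Rightarrow> 'a ip_space \<Rightarrow> (nat \<Rightarrow> 'b ip_space) \<Rightarrow> nat \<Rightarrow> (nat \<Rightarrow> 'a \<Rightarrow> 'b) \<Rightarrow> real \<Rightarrow> bool"
  where "tight_opv_frame F H Hs m V A \<longleftrightarrow>
    opv_family F H Hs m V \<and> A > 0 \<and>
    (\<forall>x\<in>carrier H.
      (\<Oplus>\<^bsub>H\<^esub>j\<in>{1..m}. hadjoint F H (Hs j) (V j) (V j x)) = complex_of_real A \<odot>\<^bsub>H\<^esub> x)"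

definition parseval_opv_frame ::
    "complex set \<Rightarrow> 'a ip_space \<Rightarrow> (nat \<Rightarrow> 'b ip_space) \<Rightarrow> nat \<Rightarrow> (nat \<Rightarrow> 'a \<Rightarrow> 'b) \<Rightarrow> bool"
  where "parseval_opv_frame F H Hs m V \<longleftrightarrow> tight_opv_frame F H Hs m V 1"

text \<open>\<open>dual_opv F H Hs m W V\<close>: the family \<open>W\<close> is dual to \<open>V\<close>.\<close>

definition dual_opv ::
    "complex set \<Rightarrow> 'a ip_space \<Rightarrow> (nat \<Rightarrow> 'b ip_space) \<Rightarrow> nat \<Rightarrow>
      (nat \<Rightarrow> 'a \<Rightarrow> 'b) \<Rightarrow> (nat \<Rightarrow> 'a \<Rightarrow> 'b) \<Rightarrow> bool"
  where "dual_opv F H Hs m W V \<longleftrightarrow>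
    opv_family F H Hs m W \<and>
    (\<forall>x\<in>carrier H. (\<Oplus>\<^bsub>H\<^esub>j\<in>{1..m}. hadjoint F H (Hs j) (W j) (V j x)) = x)"

end

theory Submission
  imports Defs
begin

text \<open>
  Pairing the three frame identities with a vector \<open>x \<noteq> 0\<close> gives \<open>\<Sum>\<parallel>V\<^sub>j x\<parallel>\<^sup>2 = \<parallel>x\<parallel>\<^sup>2\<close>,
  \<open>\<Sum>\<parallel>W\<^sub>j x\<parallel>\<^sup>2 = A \<parallel>x\<parallel>\<^sup>2\<close> and \<open>\<Sum>\<langle>V\<^sub>j x, W\<^sub>j x\<rangle> = \<parallel>x\<parallel>\<^sup>2\<close>. As \<open>2 Re \<langle>u, v\<rangle> \<le> \<parallel>u\<parallel>\<^sup>2 + \<parallel>v\<parallel>\<^sup>2\<close>,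
  this forces \<open>2 \<parallel>x\<parallel>\<^sup>2 \<le> (1 + A) \<parallel>x\<parallel>\<^sup>2\<close>. The adjoints, defined by a choice operator, obey their
  defining identity because functionals on a finite-dimensional space are represented by vectors.
\<close>

lemma scalars_simps [simp]:
  "carrier (scalars F) = F" "zero (scalars F) = 0" "one (scalars F) = 1"
  "mult (scalars F) = (*)" "add (scalars F) = (+)"
  by (simp_all add: scalars_def)

section \<open>Inner-product calculus and Cauchy-Schwarz\<close>

context hilbert_space
begin

lemma scalar_of_real: "complex_of_real r \<in> F"
  using real_or_complex by auto

lemma scalar_cnj: "c \<in> F \<Longrightarrow> cnj c \<in> F"
  using real_or_complex by (auto simp: Reals_cnj_iff)

lemma scalar_diff: "c \<in> F \<Longrightarrow> d \<in> F \<Longrightarrow> c - d \<in> F"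
  using real_or_complex by auto

lemma scalar_divide: "c \<in> F \<Longrightarrow> d \<in> F \<Longrightarrow> c / d \<in> F"
  using real_or_complex by auto

lemma smult_carrier: "c \<in> F \<Longrightarrow> x \<in> carrier H \<Longrightarrow> c \<odot>\<^bsub>H\<^esub> x \<in> carrier H"
  using smult_closed by simp

lemma ip_add_right:
  assumes "x \<in> carrier H" "y \<in> carrier H" "z \<in> carrier H"
  shows "ip H z (x \<oplus> y) = ip H z x + ip H z y"
  using assms by (metis M.add.m_closed complex_cnj_add ip_add ip_cnj)

lemma ip_smult_right:
  assumes "c \<in> F" "x \<in> carrier H" "y \<in> carrier H"
  shows "ip H y (c \<odot>\<^bsub>H\<^esub> x) = cnj c * ip H y x"
  using assms by (metis complex_cnj_mult ip_cnj ip_smult smult_carrier)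

lemma ip_zero: "x \<in> carrier H \<Longrightarrow> ip H \<zero> x = 0"
  by (metis M.l_zero M.zero_closed add_cancel_right_left ip_add)

lemma ip_zero_right: "x \<in> carrier H \<Longrightarrow> ip H x \<zero> = 0"
  by (metis M.zero_closed complex_cnj_zero ip_cnj ip_zero)

lemma ip_self_real: "x \<in> carrier H \<Longrightarrow> ip H x x = complex_of_real (Re (ip H x x))"
  by (metis Reals_cnj_iff ip_cnj of_real_Re)

lemma Re_ip_commute: "x \<in> carrier H \<Longrightarrow> y \<in> carrier H \<Longrightarrow> Re (ip H y x) = Re (ip H x y)"
  by (simp add: ip_cnj[of x y])

lemma hnorm_nonneg: "x \<in> carrier H \<Longrightarrow> 0 \<le> hnorm H x"
  by (simp add: hnorm_def ip_nonneg)

lemma hnorm_square: "x \<in> carrier H \<Longrightarrow> (hnorm H x)\<^sup>2 = Re (ip H x x)"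
  by (simp add: hnorm_def ip_nonneg)

text \<open>\<open>ip_definite\<close> needs the whole complex value to vanish; conjugate symmetry,
  through \<open>ip_self_real\<close>, reduces this to the real part.\<close>

lemma Re_ip_self_pos: "x \<in> carrier H \<Longrightarrow> x \<noteq> \<zero> \<Longrightarrow> 0 < Re (ip H x x)"
  by (metis ip_definite ip_nonneg ip_self_real of_real_0 order_le_less)

lemma ip_diff:
  assumes "x \<in> carrier H" "y \<in> carrier H" "z \<in> carrier H"
  shows "ip H (x \<ominus> y) z = ip H x z - ip H y z"
proof -
  have "ip H ((x \<ominus> y) \<oplus> y) z = ip H (x \<ominus> y) z + ip H y z"
    using assms by (intro ip_add) auto
  moreover have "(x \<ominus> y) \<oplus> y = x"
    using assms by (simp add: M.minus_eq M.a_assoc M.l_neg)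
  ultimately show ?thesis by simp
qed

lemma ip_diff_right:
  assumes "x \<in> carrier H" "y \<in> carrier H" "z \<in> carrier H"
  shows "ip H z (x \<ominus> y) = ip H z x - ip H z y"
  using assms by (metis M.minus_closed complex_cnj_diff ip_cnj ip_diff)

text \<open>Testing with the difference of the two vectors shows that its norm is 0. This is the
  uniqueness of representing vectors, from which the linearity of adjoints follows.\<close>

lemma ip_ext:
  assumes "x \<in> carrier H" "y \<in> carrier H" "\<And>z. z \<in> carrier H \<Longrightarrow> ip H z x = ip H z y"
  shows "x = y"
proof -
  have "ip H (x \<ominus> y) (x \<ominus> y) = 0"
    using assms by (simp add: ip_diff_right)
  then have "x \<ominus> y = \<zero>"
    using assms by (intro ip_definite) auto
  then show ?thesis using assms by simp
qed

text \<open>Expansion of 0 \<le> <x - t y, x - t y>. A free \<open>t\<close> serves two ends: its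
  optimal value gives Cauchy-Schwarz, and \<open>t = 1\<close> gives the inequality that is summed
  over the frame.\<close>

lemma Re_ip_scaled_le:
  assumes "x \<in> carrier H" "y \<in> carrier H"
  shows "2 * t * Re (ip H x y) \<le> Re (ip H x x) + t\<^sup>2 * Re (ip H y y)"
proof -
  let ?ty = "complex_of_real t \<odot>\<^bsub>H\<^esub> y"
  have ty: "?ty \<in> carrier H" using assms smult_carrier scalar_of_real by blast
  have "0 \<le> Re (ip H (x \<ominus> ?ty) (x \<ominus> ?ty))"
    using assms ty by (intro ip_nonneg) auto
  also have "\<dots> = Re (ip H x x) - 2 * t * Re (ip H x y) + t\<^sup>2 * Re (ip H y y)"
    using assms ty Re_ip_commute[OF assms]
    by (simp add: ip_diff ip_diff_right ip_smult ip_smult_right scalar_of_real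
        power2_eq_square algebra_simps)
  finally show ?thesis by simp
qed

lemma Re_ip_le_hnorm:
  assumes "x \<in> carrier H" "y \<in> carrier H"
  shows "Re (ip H x y) \<le> hnorm H x * hnorm H y"
proof (cases "y = \<zero>")
  case True
  then show ?thesis
    using assms by (simp add: ip_zero_right hnorm_def ip_zero)
next
  case False
  let ?s = "Re (ip H y y)" and ?p = "Re (ip H x y)"
  have s: "0 < ?s" using False assms Re_ip_self_pos by blast
  \<comment> \<open>The value \<open>?p / ?s\<close> of \<open>t\<close> minimises the quadratic in
    \<open>Re_ip_scaled_le\<close>.\<close>
  have "?p\<^sup>2 \<le> Re (ip H x x) * ?s"
    using Re_ip_scaled_le[OF assms, of "?p / ?s"] s
    by (simp add: field_simps power2_eq_square)
  also have "\<dots> = (hnorm H x * hnorm H y)\<^sup>2"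
    using assms by (simp add: power_mult_distrib hnorm_square)
  finally show ?thesis
    by (rule power2_le_imp_le) (use assms hnorm_nonneg in simp)
qed

lemma ip_finsum:
  assumes "finite I" "\<And>j. j \<in> I \<Longrightarrow> g j \<in> carrier H" "x \<in> carrier H"
  shows "ip H (\<Oplus>j\<in>I. g j) x = (\<Sum>j\<in>I. ip H (g j) x)"
  using assms
proof (induction I)
  case empty
  then show ?case by (simp add: ip_zero)
next
  case (insert i I)
  then have "g \<in> I \<rightarrow> carrier H" "g i \<in> carrier H" by auto
  with insert show ?case by (simp add: M.finsum_insert ip_add)
qed

section \<open>Riesz representation in finite dimension\<close>

definition functional :: "('a \<Rightarrow> complex) \<Rightarrow> bool"
  where "functional f \<longleftrightarrow>
    (\<forall>x\<in>carrier H. f x \<in> F) \<and>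
    (\<forall>x\<in>carrier H. \<forall>y\<in>carrier H. f (x \<oplus> y) = f x + f y) \<and>
    (\<forall>c\<in>F. \<forall>x\<in>carrier H. f (c \<odot>\<^bsub>H\<^esub> x) = c * f x)"

lemma functional_ip: "y \<in> carrier H \<Longrightarrow> functional (\<lambda>x. ip H x y)"
  by (simp add: functional_def ip_closed ip_add ip_smult)

lemma functional_zero: "functional f \<Longrightarrow> f \<zero> = 0"
  unfolding functional_def by (metis M.l_zero M.zero_closed add_cancel_right_left)

text \<open>The set where two functionals agree is a submodule, so it contains the span of
  \<open>B\<close> as soon as it contains \<open>B\<close>.\<close>

lemma functional_eq_on_span:
  assumes "functional f" "functional g" "B \<subseteq> carrier H"
    and "\<And>x. x \<in> B \<Longrightarrow> f x = g x" and "x \<in> span B"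
  shows "f x = g x"
proof -
  have "submodule (scalars F) {x \<in> carrier H. f x = g x} H"
  proof (rule submodule.intro)
    show "module (scalars F) H" by unfold_locales
  qed (use assms functional_zero[OF assms(1)] functional_zero[OF assms(2)]
      in \<open>auto simp: functional_def smult_carrier\<close>)
  from span_is_subset[OF _ this, of B] show ?thesis
    using assms by blast
qed

text \<open>Gram-Schmidt in inductive form: a new vector \<open>b\<close> is split into its
  projection \<open>p\<close> on \<open>span B\<close> and a residual \<open>r\<close> orthogonal to
  \<open>B\<close>, and the representer is corrected along \<open>r\<close>. Keeping representers
  inside \<open>span B\<close> is what makes \<open>p\<close> a projection.\<close>

lemma exists_representer_span:
  assumes "finite B" "B \<subseteq> carrier H" "functional f"
  shows "\<exists>y\<in>span B. \<forall>x\<in>B. f x = ip H x y"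
  using assms
proof (induction B arbitrary: f rule: finite_induct)
  case empty
  then show ?case
    using submodule.zero_closed[OF span_is_submodule[of "{}"]] by auto
next
  case (insert b B)
  let ?S = "span (insert b B)"
  have B: "B \<subseteq> carrier H" and b: "b \<in> carrier H" using insert.prems by auto
  note sub = submodule.m_closed[OF span_is_submodule[OF insert.prems(1)]]
    submodule.smult_closed[OF span_is_submodule[OF insert.prems(1)]]
  have mono: "span B \<subseteq> ?S" unfolding span_def by blast
  have inS: "?S \<subseteq> carrier H" and inB: "span B \<subseteq> carrier H"
    using insert.prems B span_is_subset2 by auto
  obtain y where y: "y \<in> span B" "\<And>x. x \<in> B \<Longrightarrow> f x = ip H x y"
    using insert.IH[OF B insert.prems(2)] by blast
  \<comment> \<open>The projection of \<open>b\<close> represents the functional <., b> on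
    \<open>B\<close>; hence the induction is over arbitrary \<open>f\<close>.\<close>
  obtain p where p: "p \<in> span B" "\<And>x. x \<in> B \<Longrightarrow> ip H x b = ip H x p"
    using insert.IH[OF B functional_ip[OF b]] by blast
  have yc: "y \<in> carrier H" and pc: "p \<in> carrier H" using y p inB by auto
  \<comment> \<open>This is b - p, written with a scalar so that the closure rules of a submodule
    apply.\<close>
  define r where "r = b \<oplus> (- 1) \<odot>\<^bsub>H\<^esub> p"
  have m1: "-1 \<in> F" using scalar_of_real[of "-1"] by simp
  have bS: "b \<in> ?S" using in_own_span[OF insert.prems(1)] by auto
  have rS: "r \<in> ?S" unfolding r_def using bS p mono m1 by (auto intro!: sub)
  have rc: "r \<in> carrier H" using rS inS by auto
  have ip_r: "ip H x r = ip H x b - ip H x p" if "x \<in> carrier H" for x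
    using that b pc m1 by (simp add: r_def ip_add_right ip_smult_right smult_carrier)
  have r_orth: "ip H x r = 0" if "x \<in> B" for x
    using that B p(2) ip_r by auto
  \<comment> \<open>Orthogonality to \<open>r\<close> passes from \<open>B\<close> to its span by
    comparison with the zero functional.\<close>
  have pr: "ip H p r = 0"
    using functional_eq_on_span[OF functional_ip[OF rc] _ B _ p(1), of "\<lambda>_. 0"] r_orth
      scalar_of_real[of 0] by (simp add: functional_def)
  have "ip H r z = ip H b z - ip H p z" if "z \<in> carrier H" for z
    using that b pc m1 by (simp add: r_def ip_add ip_smult smult_carrier)
  then have br: "ip H b r = ip H r r"
    using pr rc by simp
  show ?case
  proof (cases "r = \<zero>")
    \<comment> \<open>Here \<open>b\<close> already lies in \<open>span B\<close>, so the old
      representer \<open>y\<close> is also right at \<open>b\<close>.\<close>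
    case True
    have "b = p"
      using ip_r True by (intro ip_ext[OF b pc]) (simp add: ip_zero_right)
    then have "f b = ip H b y"
      using functional_eq_on_span[OF insert.prems(2) functional_ip[OF yc] B y(2)] p(1) by simp
    then show ?thesis using y mono by (intro bexI[of _ y]) auto
  next
    case False
    \<comment> \<open>Adding a multiple of \<open>r\<close> changes nothing on \<open>B\<close>, and
      <b, r> = <r, r> by \<open>br\<close>; so this coefficient repairs the value at
      \<open>b\<close>. The conjugate compensates for conjugate-linearity in the second
      argument.\<close>
    define c where "c = cnj ((f b - ip H b y) / ip H r r)"
    have fb: "f b \<in> F" using insert.prems(2) b by (simp add: functional_def)
    have c: "c \<in> F" unfolding c_def
      using fb b yc rc by (intro scalar_cnj scalar_divide scalar_diff ip_closed)
    have ip_y': "ip H x (y \<oplus> c \<odot>\<^bsub>H\<^esub> r) = ip H x y + cnj c * ip H x r" if "x \<in> carrier H" for x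
      using that c yc rc by (simp add: ip_add_right ip_smult_right smult_carrier)
    have "ip H r r \<noteq> 0" using False rc ip_definite by blast
    then have "ip H b (y \<oplus> c \<odot>\<^bsub>H\<^esub> r) = f b"
      unfolding ip_y'[OF b] br by (simp add: c_def)
    moreover have "f x = ip H x (y \<oplus> c \<odot>\<^bsub>H\<^esub> r)" if "x \<in> B" for x
      using that B y(2) r_orth by (simp add: ip_y' subset_iff)
    moreover have "y \<oplus> c \<odot>\<^bsub>H\<^esub> r \<in> ?S"
      using y(1) mono rS c by (auto intro!: sub)
    ultimately show ?thesis by (intro bexI[of _ "y \<oplus> c \<odot>\<^bsub>H\<^esub> r"]) auto
  qed
qed

lemma exists_representer:
  assumes "fin_dim" "functional f"
  shows "\<exists>y\<in>carrier H. \<forall>x\<in>carrier H. f x = ip H x y"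
proof -
  obtain B where B: "finite B" "B \<subseteq> carrier H" "span B = carrier H"
    using assms(1) unfolding fin_dim_def by blast
  obtain y where y: "y \<in> span B" "\<And>x. x \<in> B \<Longrightarrow> f x = ip H x y"
    using exists_representer_span[OF B(1,2) assms(2)] by blast
  with B show ?thesis
    using functional_eq_on_span[OF assms(2) functional_ip B(2) y(2)] by blast
qed

end

section \<open>Adjoints of bounded operators\<close>

lemma bounded_ops_closed:
  assumes "T \<in> bounded_ops F H K" "x \<in> carrier H"
  shows "T x \<in> carrier K"
  using assms by (auto simp: bounded_ops_def linear_map_def mod_hom_def mod_hom_axioms_def
      module_hom_def)

lemma bounded_ops_hom:
  assumes "T \<in> bounded_ops F H K" "x \<in> carrier H"
  shows "y \<in> carrier H \<Longrightarrow> T (x \<oplus>\<^bsub>H\<^esub> y) = T x \<oplus>\<^bsub>K\<^esub> T y"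
    and "c \<in> F \<Longrightarrow> T (c \<odot>\<^bsub>H\<^esub> x) = c \<odot>\<^bsub>K\<^esub> T x"
  using assms by (auto simp: bounded_ops_def linear_map_def mod_hom_def mod_hom_axioms_def
      module_hom_def)

text \<open>\<open>S y\<close> is the vector representing x \<mapsto> <T x, y>. Linearity follows
  from uniqueness of representers, boundedness from Cauchy-Schwarz.\<close>

lemma exists_adjoint:
  assumes "hilbert_space F H" "vectorspace.fin_dim (scalars F) H" "hilbert_space F K"
    and T: "T \<in> bounded_ops F H K"
  shows "\<exists>S. S \<in> bounded_ops F K H \<and>
    (\<forall>x\<in>carrier H. \<forall>y\<in>carrier K. ip K (T x) y = ip H x (S y))"
proof -
  interpret H: hilbert_space F H by fact
  interpret K: hilbert_space F K by fact
  note TK = bounded_ops_closed[OF T] and hom = bounded_ops_hom[OF T]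
  have "\<exists>z\<in>carrier H. \<forall>x\<in>carrier H. ip K (T x) y = ip H x z" if "y \<in> carrier K" for y
  proof (rule H.exists_representer[OF assms(2)])
    show "H.functional (\<lambda>x. ip K (T x) y)"
      using that TK
      by (simp add: H.functional_def hom K.ip_closed K.ip_add K.ip_smult)
  qed
  then obtain S where SH: "\<And>y. y \<in> carrier K \<Longrightarrow> S y \<in> carrier H"
    and S: "\<And>x y. y \<in> carrier K \<Longrightarrow> x \<in> carrier H \<Longrightarrow> ip K (T x) y = ip H x (S y)"
    by metis
  have "S (y \<oplus>\<^bsub>K\<^esub> z) = S y \<oplus>\<^bsub>H\<^esub> S z" if "y \<in> carrier K" "z \<in> carrier K" for y z
    using that SH TK by (intro H.ip_ext) (simp_all add: S[symmetric] K.ip_add_right H.ip_add_right)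
  moreover have "S (c \<odot>\<^bsub>K\<^esub> y) = c \<odot>\<^bsub>H\<^esub> S y" if "c \<in> F" "y \<in> carrier K" for c y
    using that SH TK by (intro H.ip_ext)
      (simp_all add: S[symmetric] K.ip_smult_right H.ip_smult_right K.smult_carrier H.smult_carrier)
  ultimately have "linear_map (scalars F) K H S"
    using SH by unfold_locales (auto simp: module_hom_def)
  moreover obtain C where C: "\<And>x. x \<in> carrier H \<Longrightarrow> hnorm K (T x) \<le> C * hnorm H x"
    using T by (auto simp: bounded_ops_def)
  have "hnorm H (S y) \<le> \<bar>C\<bar> * hnorm K y" if y: "y \<in> carrier K" for y
  \<comment> \<open>The main estimate bounds the square of the norm of \<open>S y\<close> by a
    multiple of that norm, which must be positive to be cancelled. The absolute value of
    \<open>C\<close> covers the zero case, since \<open>bounded_ops\<close> states no sign for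
    \<open>C\<close>.\<close>
  proof (cases "hnorm H (S y) = 0")
    case True
    then show ?thesis using K.hnorm_nonneg[OF y] by simp
  next
    case False
    then have pos: "0 < hnorm H (S y)" using H.hnorm_nonneg[OF SH[OF y]] by simp
    \<comment> \<open>The adjoint identity at x = S y.\<close>
    have "hnorm H (S y) * hnorm H (S y) = Re (ip K (T (S y)) y)"
      using H.hnorm_square[OF SH[OF y]] S y SH by (simp add: power2_eq_square)
    also have "\<dots> \<le> hnorm K (T (S y)) * hnorm K y"
      using K.Re_ip_le_hnorm TK SH y by blast
    also have "\<dots> \<le> (\<bar>C\<bar> * hnorm H (S y)) * hnorm K y"
    proof (rule mult_right_mono[OF _ K.hnorm_nonneg[OF y]])
      have "hnorm K (T (S y)) \<le> C * hnorm H (S y)" using C SH y by blast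
      also have "\<dots> \<le> \<bar>C\<bar> * hnorm H (S y)" using pos by (intro mult_right_mono) auto
      finally show "hnorm K (T (S y)) \<le> \<bar>C\<bar> * hnorm H (S y)" .
    qed
    finally have "hnorm H (S y) * hnorm H (S y) \<le> (\<bar>C\<bar> * hnorm K y) * hnorm H (S y)"
      by (simp add: mult_ac)
    then show ?thesis using pos by (rule mult_right_le_imp_le)
  qed
  ultimately have "S \<in> bounded_ops F K H" by (auto simp: bounded_ops_def)
  with S show ?thesis by blast
qed

lemma
  assumes "hilbert_space F H" "vectorspace.fin_dim (scalars F) H" "hilbert_space F K"
    and "T \<in> bounded_ops F H K"
  shows hadjoint_bounded: "hadjoint F H K T \<in> bounded_ops F K H"
    and ip_hadjoint: "\<And>x y. x \<in> carrier H \<Longrightarrow> y \<in> carrier K \<Longrightarrow>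
      ip H x (hadjoint F H K T y) = ip K (T x) y"
  using someI_ex[OF exists_adjoint[OF assms]] unfolding hadjoint_def by auto

text \<open>Taking real parts allows the arguments to be swapped without conjugation. Keeping
  \<open>T\<close> and \<open>y\<close> independent lets one statement cover both frame identities
  and the duality.\<close>

lemma Re_ip_finsum_hadjoint:
  assumes "hilbert_space F H" "vectorspace.fin_dim (scalars F) H" "finite I"
    and K: "\<And>j. j \<in> I \<Longrightarrow> hilbert_space F (K j)"
    and T: "\<And>j. j \<in> I \<Longrightarrow> T j \<in> bounded_ops F H (K j)"
    and y: "\<And>j. j \<in> I \<Longrightarrow> y j \<in> carrier (K j)" and x: "x \<in> carrier H"
  shows "Re (ip H (\<Oplus>\<^bsub>H\<^esub>j\<in>I. hadjoint F H (K j) (T j) (y j)) x) = (\<Sum>j\<in>I. Re (ip (K j) (T j x) (y j)))"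
proof -
  interpret H: hilbert_space F H by fact
  have adj: "hadjoint F H (K j) (T j) (y j) \<in> carrier H" if "j \<in> I" for j
    using that assms by (blast intro: bounded_ops_closed hadjoint_bounded)
  have "Re (ip H (hadjoint F H (K j) (T j) (y j)) x) = Re (ip (K j) (T j x) (y j))"
    if "j \<in> I" for j
    using H.Re_ip_commute[OF x adj[OF that]] that
      ip_hadjoint[OF assms(1,2) K[OF that] T[OF that] x y[OF that]] by simp
  then show ?thesis
    using assms(3) adj x by (simp add: H.ip_finsum)
qed

theorem corollary11:
  fixes F :: "complex set"
    and H :: "'a ip_space"
    and Hs :: "nat \<Rightarrow> 'b ip_space"
    and m :: nat
    and V W :: "nat \<Rightarrow> 'a \<Rightarrow> 'b"
    and A :: real
  assumes "hilbert_space F H" and "vectorspace.fin_dim (scalars F) H"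
    and "\<And>j. j \<in> {1..m} \<Longrightarrow> hilbert_space F (Hs j)"
    and "\<And>j. j \<in> {1..m} \<Longrightarrow> vectorspace.fin_dim (scalars F) (Hs j)"
    and "parseval_opv_frame F H Hs m V"
    and "tight_opv_frame F H Hs m W A"
    and "dual_opv F H Hs m W V"
  shows "A \<ge> 1"
proof -
  interpret H: hilbert_space F H by fact
  \<comment> \<open>On the zero space every A > 0 would be a frame bound, so a nonzero vector is
    essential.\<close>
  obtain x where x: "x \<in> carrier H" "x \<noteq> \<zero>\<^bsub>H\<^esub>"
    using H.nonzero H.M.zero_closed by blast
  have V: "\<And>j. j \<in> {1..m} \<Longrightarrow> V j \<in> bounded_ops F H (Hs j)"
    and W: "\<And>j. j \<in> {1..m} \<Longrightarrow> W j \<in> bounded_ops F H (Hs j)"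
    using assms(5,6)
    by (auto simp: parseval_opv_frame_def tight_opv_frame_def opv_family_def)
  have Vx: "\<And>j. j \<in> {1..m} \<Longrightarrow> V j x \<in> carrier (Hs j)"
    and Wx: "\<And>j. j \<in> {1..m} \<Longrightarrow> W j x \<in> carrier (Hs j)"
    using V W x(1) by (blast intro: bounded_ops_closed)+
  have pairing: "Re (ip H (\<Oplus>\<^bsub>H\<^esub>j\<in>{1..m}. hadjoint F H (Hs j) (T j) (y j)) x) =
      (\<Sum>j\<in>{1..m}. Re (ip (Hs j) (T j x) (y j)))"
    if "\<And>j. j \<in> {1..m} \<Longrightarrow> T j \<in> bounded_ops F H (Hs j)"
      and "\<And>j. j \<in> {1..m} \<Longrightarrow> y j \<in> carrier (Hs j)" for T y
    using assms(1-3) that x(1) by (intro Re_ip_finsum_hadjoint) auto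
  have VV: "(\<Sum>j\<in>{1..m}. Re (ip (Hs j) (V j x) (V j x))) = Re (ip H x x)"
    using pairing[of V "\<lambda>j. V j x", OF V Vx] assms(5) x(1) H.scalar_of_real[of 1]
    by (simp add: parseval_opv_frame_def tight_opv_frame_def H.ip_smult)
  have WW: "(\<Sum>j\<in>{1..m}. Re (ip (Hs j) (W j x) (W j x))) = A * Re (ip H x x)"
    using pairing[of W "\<lambda>j. W j x", OF W Wx] assms(6) x(1) H.scalar_of_real
    by (simp add: tight_opv_frame_def H.ip_smult)
  have WV: "(\<Sum>j\<in>{1..m}. Re (ip (Hs j) (W j x) (V j x))) = Re (ip H x x)"
    using pairing[of W "\<lambda>j. V j x", OF W Vx] assms(7) x(1) by (simp add: dual_opv_def)
  have "2 * Re (ip H x x) = (\<Sum>j\<in>{1..m}. 2 * Re (ip (Hs j) (W j x) (V j x)))"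
    by (simp only: WV sum_distrib_left[symmetric])
  \<comment> \<open>Termwise \<open>Re_ip_scaled_le\<close> with \<open>t = 1\<close>, used inside
    each space \<open>Hs j\<close>.\<close>
  also have "\<dots> \<le> (\<Sum>j\<in>{1..m}. Re (ip (Hs j) (W j x) (W j x)) + Re (ip (Hs j) (V j x) (V j x)))"
    using hilbert_space.Re_ip_scaled_le[OF assms(3) Wx Vx, where t = 1] by (intro sum_mono) simp
  also have "\<dots> = (A + 1) * Re (ip H x x)"
    unfolding sum.distrib VV WW by (simp add: algebra_simps)
  finally have "2 * Re (ip H x x) \<le> (A + 1) * Re (ip H x x)" .
  then show ?thesis
    using H.Re_ip_self_pos[OF x] by simp
qed

end
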